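(* Let $(\mathscr M,g)$ be a pp-wave space-time of dimension $d+2\ge 4$ with the metric $ds^2=2\,du\,dv+H(\vec x,u)\,du^2+\sum_{\rho=1}^d (dx^\rho)^2$. If $\sum_{\rho=1}^d \partial^2 H/\partial (x^\rho)^2$ depends only on $u$, then the metric solves the field equations of the generic theory of gravitation (with cosmological constant $\Lambda_0=0$) with pure radiation source, i.e. it satisfies $$[a_0+a_1\nabla^2+a_2(\nabla^2)^2+\dots]R_{kl}=T_{kl}$$ with $T_{kl}$ a pure radiation energy-momentum tensor.
   Context: $\nabla$ is the Levi-Civita connection, $\nabla^2=\nabla^k\nabla_k$, and $R_{kl}$ is the Ricci tensor. The metric is written in local coordinates $(u,\vec x,v)$, $\vec x=(x^1,\dots,x^d)$, with $H(\vec x,u)$ smooth and independent of $v$. For this metric $R_{kl}=\psi X_kX_l$ with $\psi=-\tfrac12\sum_{\rho=1}^d\partial^2H/\partial (x^{\rho})^2$ and $X_k=\nabla_k u$ null and covariantly constant. The generic theory of gravitation in dimension $n$ has, with zero source, the action $$I=\int d^nx\sqrt{-g}\Big[R-2\Lambda_0+\alpha R^2+\beta R_{ij}R^{ij}+\gamma(R_{jklm}R^{jklm}-4R_{jk}R^{jk}+R^2)+\sum_{p>2}C_p(\mathrm{Riem},\mathrm{Ric},\nabla\mathrm{Riem},\dots)\Big],$$ with parameters $\alpha,\beta,\gamma,C_p$, where the terms of higher order are contracted products of the Riemann tensor and its derivatives. It is known (Gürses et al.) that for pp-wave metrics of the form $ds^2=2\,du\,dv+H(\vec x,u)\,du^2+\sum_{\rho=1}^d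 (dx^\rho)^2$ and $\Lambda_0=0$ the source-free field equations may be written as $[a_0+a_1\nabla^2+a_2(\nabla^2)^2+\dots]R_{kl}=0$, where the $a_i$ are constants depending on $\alpha,\beta,\gamma,C_p$; the field equations with source have $T_{kl}$ on the right-hand side, and for pp-waves with $\nabla^2R_{kl}=0$ they read $a_0R_{kl}=T_{kl}$. A pure radiation source is $T_{ij}=\Phi^2k_ik_j$ with $k_ik^i=0$.
   Formalization: T = Φ²kk with real Φ is proved only if a_0 times the transverse Laplacian of H is ≤ 0, as otherwise it fails (a_0=1, H=|x|²: T_uu<0); without this condition T = F kk is proved with k null and F real of either sign. *)

theory Defs
  imports "HOL-Analysis.Analysis"
begin

section \<open>Smooth functions and partial derivatives\<close>

fun C_diff_on :: "nat \<Rightarrow> 'a::real_normed_vector set \<Rightarrow> ('a \<Rightarrow> 'b::real_normed_vector) \<Rightarrow> bool"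
  where
  "C_diff_on 0 S f \<longleftrightarrow> continuous_on S f"
| "C_diff_on (Suc n) S f \<longleftrightarrow>
     (\<forall>x\<in>S. f differentiable (at x)) \<and>
     (\<forall>w. C_diff_on n S (\<lambda>x. frechet_derivative f (at x) w))"

text \<open>Only used for open \<open>S\<close>.\<close>

definition smooth_on :: "'a::real_normed_vector set \<Rightarrow> ('a \<Rightarrow> 'b::real_normed_vector) \<Rightarrow> bool"
  where "smooth_on S f \<longleftrightarrow> (\<forall>n. C_diff_on n S f)"

definition pderiv_at :: "'n::finite \<Rightarrow> (real^'n \<Rightarrow> real) \<Rightarrow> real^'n \<Rightarrow> real"
  where "pderiv_at i f p = frechet_derivative f (at p) (axis i 1)"


section \<open>Levi-Civita connection and Ricci tensor in a coordinate chart\<close>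

text \<open>
  A covariant tensor field of rank two on a coordinate domain is given by its component matrix,
  \<open>T p $ k $ l\<close> being the component \<open>T\<^sub>k\<^sub>l\<close> at the point with coordinates \<open>p\<close>.
  All operators below are local: on an open set they depend only on the values of their
  arguments there.
\<close>

type_synonym 'n tensor2 = "real^'n \<Rightarrow> real^'n^'n"

definition inv_metric :: "'n::finite tensor2 \<Rightarrow> 'n tensor2"
  where "inv_metric g p = matrix_inv (g p)"

text \<open>\<open>christoffel g s k l\<close> is the symbol with upper index \<open>s\<close> and lower indices \<open>k\<close>, \<open>l\<close>.\<close>

definition christoffel :: "'n::finite tensor2 \<Rightarrow> 'n \<Rightarrow> 'n \<Rightarrow> 'n \<Rightarrow> real^'n \<Rightarrow> real"
  where "christoffel g s k l p =
    (\<Sum>m\<in>UNIV. inv_metric g p $ s $ m *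
       (pderiv_at k (\<lambda>q. g q $ m $ l) p + pderiv_at l (\<lambda>q. g q $ m $ k) p
        - pderiv_at m (\<lambda>q. g q $ k $ l) p)) / 2"

text \<open>
  \<open>riemann g i j k l\<close> has upper index \<open>i\<close> and lower indices \<open>j\<close>, \<open>k\<close>, \<open>l\<close>; the sign is such that
  \<open>[\<nabla>\<^sub>k, \<nabla>\<^sub>l]\<close> acts on vector fields by contraction with \<open>j\<close>. Contracting \<open>i\<close> with \<open>k\<close>
  gives a Ricci tensor that is positive on round spheres; for the pp-waves below its
  \<open>uu\<close>-component is minus one half of the transverse Laplacian of \<open>H\<close>.
\<close>

definition riemann :: "'n::finite tensor2 \<Rightarrow> 'n \<Rightarrow> 'n \<Rightarrow> 'n \<Rightarrow> 'n \<Rightarrow> real^'n \<Rightarrow> real"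
  where "riemann g i j k l p =
    pderiv_at k (christoffel g i l j) p - pderiv_at l (christoffel g i k j) p
    + (\<Sum>s\<in>UNIV. christoffel g i k s p * christoffel g s l j p)
    - (\<Sum>s\<in>UNIV. christoffel g i l s p * christoffel g s k j p)"

definition ricci :: "'n::finite tensor2 \<Rightarrow> 'n tensor2"
  where "ricci g p = (\<chi> j l. \<Sum>i\<in>UNIV. riemann g i j i l p)"

text \<open>
  \<open>cov_deriv2 g T m k l\<close> is \<open>\<nabla>\<^sub>m T\<^sub>k\<^sub>l\<close>, and \<open>cov_deriv3 g S m n k l\<close> is
  \<open>\<nabla>\<^sub>m S\<^sub>n\<^sub>k\<^sub>l\<close> for a covariant tensor field \<open>S\<close> of rank three.
\<close>

definition cov_deriv2 ::
  "'n::finite tensor2 \<Rightarrow> 'n tensor2 \<Rightarrow> 'n \<Rightarrow> 'n \<Rightarrow> 'n \<Rightarrow> real^'n \<Rightarrow> real"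
  where "cov_deriv2 g T m k l p =
    pderiv_at m (\<lambda>q. T q $ k $ l) p
    - (\<Sum>s\<in>UNIV. christoffel g s m k p * T p $ s $ l)
    - (\<Sum>s\<in>UNIV. christoffel g s m l p * T p $ k $ s)"

definition cov_deriv3 ::
  "'n::finite tensor2 \<Rightarrow> ('n \<Rightarrow> 'n \<Rightarrow> 'n \<Rightarrow> real^'n \<Rightarrow> real)
    \<Rightarrow> 'n \<Rightarrow> 'n \<Rightarrow> 'n \<Rightarrow> 'n \<Rightarrow> real^'n \<Rightarrow> real"
  where "cov_deriv3 g S m n k l p =
    pderiv_at m (S n k l) p
    - (\<Sum>s\<in>UNIV. christoffel g s m n p * S s k l p)
    - (\<Sum>s\<in>UNIV. christoffel g s m k p * S n s l p)
    - (\<Sum>s\<in>UNIV. christoffel g s m l p * S n k s p)"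

text \<open>The operator \<open>\<nabla>\<^sup>2 = \<nabla>\<^sup>m\<nabla>\<^sub>m\<close> on covariant tensor fields of rank two.\<close>

definition box :: "'n::finite tensor2 \<Rightarrow> 'n tensor2 \<Rightarrow> 'n tensor2"
  where "box g T p =
    (\<chi> k l. \<Sum>m\<in>UNIV. \<Sum>n\<in>UNIV. inv_metric g p $ m $ n * cov_deriv3 g (cov_deriv2 g T) m n k l p)"


section \<open>Field equations and pure radiation\<close>

text \<open>
  \<open>[a\<^sub>0 + a\<^sub>1\<nabla>\<^sup>2 + a\<^sub>2(\<nabla>\<^sup>2)\<^sup>2 + \<dots>] R\<^sub>k\<^sub>l = T\<^sub>k\<^sub>l\<close> on the domain \<open>W\<close>. The series converges pointwise in every
  component; a theory of finite order has \<open>a i = 0\<close> for almost all \<open>i\<close>.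
\<close>

definition generic_field_equations ::
  "(nat \<Rightarrow> real) \<Rightarrow> (real^'n) set \<Rightarrow> 'n::finite tensor2 \<Rightarrow> 'n tensor2 \<Rightarrow> bool"
  where "generic_field_equations a W g T \<longleftrightarrow>
    (\<forall>p\<in>W. \<forall>k l. (\<lambda>i. a i * ((box g ^^ i) (ricci g)) p $ k $ l) sums (T p $ k $ l))"

text \<open>\<open>T\<^sub>i\<^sub>j = F k\<^sub>i k\<^sub>j\<close> for a nowhere vanishing null covector field \<open>k\<close>; \<open>F\<close> may have either sign.\<close>

definition null_radiation ::
  "(real^'n) set \<Rightarrow> 'n::finite tensor2 \<Rightarrow> (real^'n \<Rightarrow> real) \<Rightarrow> 'n tensor2 \<Rightarrow> bool"
  where "null_radiation W g F T \<longleftrightarrow>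
    (\<exists>k :: real^'n \<Rightarrow> real^'n. smooth_on W k \<and>
      (\<forall>p\<in>W. k p \<noteq> 0 \<and>
        (\<Sum>i\<in>UNIV. \<Sum>j\<in>UNIV. inv_metric g p $ i $ j * k p $ i * k p $ j) = 0 \<and>
        (\<forall>i j. T p $ i $ j = F p * k p $ i * k p $ j)))"

text \<open>\<open>\<Phi>\<close> is not required to be smooth: a smooth nonnegative function need not have a smooth root.\<close>

definition pure_radiation :: "(real^'n) set \<Rightarrow> 'n::finite tensor2 \<Rightarrow> 'n tensor2 \<Rightarrow> bool"
  where "pure_radiation W g T \<longleftrightarrow>
    (\<exists>\<Phi> :: real^'n \<Rightarrow> real. null_radiation W g (\<lambda>p. (\<Phi> p)\<^sup>2) T)"


section \<open>pp-waves\<close>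

text \<open>Labels of the coordinates \<open>u\<close>, \<open>x\<^sup>\<rho>\<close> and \<open>v\<close>.\<close>

datatype 'd coord = CU | CX 'd | CV

instance coord :: (finite) finite
proof
  have "(UNIV :: 'a coord set) = insert CU (insert CV (range CX))"
    by (auto intro: coord.exhaust)
  then show "finite (UNIV :: 'a coord set)"
    by (metis finite_code finite_imageI finite_insert)
qed

definition u_of :: "real^('d::finite coord) \<Rightarrow> real"
  where "u_of p = p $ CU"

definition x_of :: "real^('d::finite coord) \<Rightarrow> real^'d"
  where "x_of p = (\<chi> \<rho>. p $ CX \<rho>)"

text \<open>The mixed term \<open>2 du dv\<close> contributes \<open>1\<close> to each of the two components \<open>uv\<close> and \<open>vu\<close>.\<close>

definition pp_metric :: "(real^'d \<Rightarrow> real \<Rightarrow> real) \<Rightarrow> 'd::finite coord tensor2"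
  where "pp_metric H p = (\<chi> k l. case (k, l) of
      (CU, CU) \<Rightarrow> H (x_of p) (u_of p)
    | (CU, CV) \<Rightarrow> 1
    | (CV, CU) \<Rightarrow> 1
    | (CX \<rho>, CX \<sigma>) \<Rightarrow> (if \<rho> = \<sigma> then 1 else 0)
    | _ \<Rightarrow> 0)"

definition transverse_laplacian :: "(real^'d::finite \<Rightarrow> real \<Rightarrow> real) \<Rightarrow> real^'d \<Rightarrow> real \<Rightarrow> real"
  where "transverse_laplacian H x u =
    (\<Sum>\<rho>\<in>UNIV. pderiv_at \<rho> (pderiv_at \<rho> (\<lambda>y. H y u)) x)"

end

theory Submission imports Defs begin

text \<open>
  All Christoffel symbols with upper index \<open>u\<close> vanish, so on tensors whose only nonzero component
  is the one with all indices \<open>u\<close>, covariant and partial derivatives agree. The Ricci tensor is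
  \<open>\<psi> du\<^sup>2\<close> with \<open>\<psi>\<close> a function of \<open>u\<close>, hence only \<open>\<nabla>\<^sub>u R\<^sub>u\<^sub>u\<close> and \<open>\<nabla>\<^sub>u \<nabla>\<^sub>u R\<^sub>u\<^sub>u\<close> survive;
  since \<open>g\<^sup>u\<^sup>u = 0\<close>, the contraction gives \<open>\<nabla>\<^sup>2 R = 0\<close>. The series reduces to \<open>a\<^sub>0 R\<close>, which is
  pure radiation along the null covector \<open>du\<close>.
\<close>

section \<open>Partial derivatives and smooth functions\<close>

lemma pderiv_at_eqI: "(f has_derivative D) (at p) \<Longrightarrow> pderiv_at i f p = D (axis i 1)"
  unfolding pderiv_at_def by (metis frechet_derivative_at)

lemma pderiv_at_const [simp]: "pderiv_at i (\<lambda>_. c) p = 0"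
  using pderiv_at_eqI[OF has_derivative_const] .

text \<open>\<open>frechet_derivative\<close> is a choice from the predicate
  \<open>has_derivative\<close>. That predicate is local, so both sides choose from the same one and
  agree even at points without a derivative.\<close>

lemma pderiv_at_cong_open:
  assumes "open W" "p \<in> W" "\<And>q. q \<in> W \<Longrightarrow> f q = g q"
  shows "pderiv_at i f p = pderiv_at i g p"
proof -
  have "(f has_derivative D) (at p) \<longleftrightarrow> (g has_derivative D) (at p)" for D
    using assms by (metis has_derivative_transform_within_open)
  then show ?thesis
    by (simp add: pderiv_at_def frechet_derivative_def)
qed

lemma smooth_on_differentiable: "smooth_on S f \<Longrightarrow> x \<in> S \<Longrightarrow> f differentiable (at x)"
  unfolding smooth_on_def by (metis C_diff_on.simps(2))

lemma smooth_on_frechet_derivative: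
  "smooth_on S f \<Longrightarrow> smooth_on S (\<lambda>x. frechet_derivative f (at x) w)"
  unfolding smooth_on_def by (metis C_diff_on.simps(2))

lemma C_diff_on_const: "C_diff_on n S (\<lambda>_. c)"
proof (induction n arbitrary: c)
  case (Suc n)
  then show ?case
    by (simp add: frechet_derivative_const)
qed simp

lemma smooth_on_const: "smooth_on S (\<lambda>_. c)"
  by (simp add: smooth_on_def C_diff_on_const)

section \<open>Matrix inverses and sums over the coordinate labels\<close>

lemma matrix_inv_eqI:
  fixes A :: "'a::semiring_1^'n^'m"
  assumes "A ** B = mat 1" "B ** A = mat 1"
  shows "matrix_inv A = B"
proof -
  have "A ** matrix_inv A = mat 1 \<and> matrix_inv A ** A = mat 1"
    unfolding matrix_inv_def by (rule someI[of _ B]) (use assms in blast)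
  then show ?thesis
    using assms(2) by (metis matrix_mul_assoc matrix_mul_lid matrix_mul_rid)
qed

lemma UNIV_coord: "(UNIV :: 'd coord set) = insert CU (insert CV (range CX))"
  by (auto intro: coord.exhaust)

lemma sum_coord:
  fixes f :: "'d::finite coord \<Rightarrow> 'b::comm_monoid_add"
  shows "(\<Sum>k\<in>UNIV. f k) = f CU + f CV + (\<Sum>\<rho>\<in>UNIV. f (CX \<rho>))"
proof -
  have "(\<Sum>k\<in>range CX. f k) = (\<Sum>\<rho>\<in>UNIV. f (CX \<rho>))"
    by (subst sum.reindex) (auto simp: inj_on_def)
  then show ?thesis
    by (simp add: UNIV_coord image_iff add.assoc)
qed

section \<open>Forgetting the coordinate v\<close>

definition pp_proj :: "real^('d::finite coord) \<Rightarrow> (real^'d) \<times> real"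
  where "pp_proj p = (x_of p, u_of p)"

lemma pp_proj_axis [simp]:
  "pp_proj (axis CU 1) = (0, 1)"
  "pp_proj (axis (CX \<rho>) 1) = (axis \<rho> 1, 0)"
  "pp_proj (axis CV 1) = 0"
  by (auto simp: pp_proj_def x_of_def u_of_def axis_def vec_eq_iff zero_prod_def)

lemma linear_pp_proj: "linear pp_proj"
  by (rule linearI) (auto simp: pp_proj_def x_of_def u_of_def vec_eq_iff)

lemma surj_pp_proj: "surj (pp_proj :: real^('d::finite coord) \<Rightarrow> _)"
proof (rule surjI)
  fix z :: "(real^'d) \<times> real"
  show "pp_proj (\<chi> k. case k of CU \<Rightarrow> snd z | CX \<rho> \<Rightarrow> fst z $ \<rho> | CV \<Rightarrow> 0) = z"
    by (simp add: pp_proj_def x_of_def u_of_def)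
qed

text \<open>Chain rule with a linear inner map, which is its own derivative. The factorization
  through \<open>pp_proj\<close> is asked on \<open>W\<close> alone because the formulas for the
  connection and curvature are available only there.\<close>

lemma pderiv_at_comp_proj:
  fixes F :: "(real^'d::finite) \<times> real \<Rightarrow> real"
  assumes "open W" "p \<in> W" "\<And>q. q \<in> W \<Longrightarrow> f q = F (pp_proj q)"
    and "F differentiable (at (pp_proj p))"
  shows "pderiv_at k f p = frechet_derivative F (at (pp_proj p)) (pp_proj (axis k 1))"
proof -
  have "(pp_proj has_derivative pp_proj) (at p)"
    by (simp add: linear_pp_proj linear_imp_has_derivative)
  moreover have "(F has_derivative frechet_derivative F (at (pp_proj p))) (at (pp_proj p))"
    using assms(4) by (simp add: frechet_derivative_works)
  ultimately have "((\<lambda>q. F (pp_proj q)) has_derivative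
      (\<lambda>h. frechet_derivative F (at (pp_proj p)) (pp_proj h))) (at p)"
    by (rule has_derivative_compose)
  then show ?thesis
    using pderiv_at_cong_open[OF assms(1-3)] pderiv_at_eqI by fastforce
qed

lemma pderiv_at_v_comp_proj:
  fixes F :: "(real^'d::finite) \<times> real \<Rightarrow> real"
  assumes "open W" "p \<in> W" "\<And>q. q \<in> W \<Longrightarrow> f q = F (pp_proj q)"
    and "F differentiable (at (pp_proj p))"
  shows "pderiv_at CV f p = 0"
proof -
  have "linear (frechet_derivative F (at (pp_proj p)))"
    using assms(4) by (rule linear_frechet_derivative)
  then show ?thesis
    using pderiv_at_comp_proj[OF assms] by (simp add: linear_0)
qed

text \<open>Links derivatives at frozen u, as in \<open>transverse_laplacian\<close>, to joint
  derivatives in (x, u): the slice of \<open>V\<close> at u is open, and y -> (y, u) has derivative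
  h -> (h, 0).\<close>

lemma pderiv_at_slice:
  fixes F :: "(real^'d::finite) \<times> real \<Rightarrow> real"
  assumes "open V" "(x, u) \<in> V" "\<And>y. (y, u) \<in> V \<Longrightarrow> f y = F (y, u)"
    and "F differentiable (at (x, u))"
  shows "pderiv_at \<rho> f x = frechet_derivative F (at (x, u)) (axis \<rho> 1, 0)"
proof -
  let ?S = "{y. (y, u) \<in> V}"
  have "?S = (\<lambda>y. (y, u)) -` V"
    by auto
  then have S: "open ?S"
    using assms(1) by (auto intro!: open_vimage continuous_intros)
  have "((\<lambda>y. (y, u)) has_derivative (\<lambda>h. (h, 0))) (at x)"
    by (auto intro!: derivative_eq_intros)
  moreover have "(F has_derivative frechet_derivative F (at (x, u))) (at (x, u))"
    using assms(4) by (simp add: frechet_derivative_works)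
  ultimately have "((\<lambda>y. F (y, u)) has_derivative
      (\<lambda>h. frechet_derivative F (at (x, u)) (h, 0))) (at x)"
    by (rule has_derivative_compose)
  then show ?thesis
    using pderiv_at_cong_open[OF S, of x f "\<lambda>y. F (y, u)"] assms(2,3) pderiv_at_eqI by fastforce
qed

section \<open>Metric coefficients and inverse metric\<close>

lemma inv_metric_pp_metric:
  "inv_metric (pp_metric H) p = (\<chi> k l. case (k, l) of
      (CU, CV) \<Rightarrow> 1
    | (CV, CU) \<Rightarrow> 1
    | (CV, CV) \<Rightarrow> - H (x_of p) (u_of p)
    | (CX \<rho>, CX \<sigma>) \<Rightarrow> (if \<rho> = \<sigma> then 1 else 0)
    | _ \<Rightarrow> 0)" (is "_ = ?B")
proof -
  \<comment> \<open>The (u, v) block with rows (H, 1), (1, 0) has the inverse with rows (0, 1), (1,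
    -H); the transverse block is the identity.\<close>
  have "pp_metric H p ** ?B = mat 1"
    by (auto simp: vec_eq_iff matrix_matrix_mult_def mat_def sum_coord pp_metric_def if_distrib if_distribR
        cong: if_cong split: coord.split)
  moreover from this have "?B ** pp_metric H p = mat 1"
    using matrix_left_right_inverse by blast
  ultimately show ?thesis
    unfolding inv_metric_def by (rule matrix_inv_eqI)
qed

lemma pderiv_at_pp_metric:
  "pderiv_at k (\<lambda>q. pp_metric H q $ m $ l) p =
    (if m = CU \<and> l = CU then pderiv_at k (\<lambda>q. H (x_of q) (u_of q)) p else 0)"
  by (cases m; cases l) (auto simp: pp_metric_def)

section \<open>Connection and Ricci tensor of a pp-wave\<close>

locale pp_chart =
  fixes H :: "real^'d::finite \<Rightarrow> real \<Rightarrow> real" and W :: "(real^'d coord) set"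
  assumes open_W: "open W"
    and smooth_H: "smooth_on (pp_proj ` W) (\<lambda>(x, u). H x u)"
begin

text \<open>
  Every function of the chart is written as a function on the open image of \<open>W\<close> composed with the
  linear map \<open>pp_proj\<close>: this makes all \<open>v\<close>-derivatives vanish and gives differentiability for free.
\<close>

definition dH :: "'d coord \<Rightarrow> (real^'d) \<times> real \<Rightarrow> real"
  where "dH k z = frechet_derivative (\<lambda>(x, u). H x u) (at z) (pp_proj (axis k 1))"

text \<open>The \<open>uu\<close> coefficient of the Ricci tensor, built from joint derivatives in
  (x, u) so that it can be differentiated in u as well.\<close>

definition psi :: "(real^'d) \<times> real \<Rightarrow> real"
  where "psi z = - (\<Sum>\<rho>\<in>UNIV. frechet_derivative (dH (CX \<rho>)) (at z) (axis \<rho> 1, 0)) / 2"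

lemma open_proj_W: "open (pp_proj ` W)"
  using open_W linear_pp_proj surj_pp_proj by (rule open_surjective_linear_image)

lemma smooth_dH: "smooth_on (pp_proj ` W) (dH k)"
  unfolding dH_def using smooth_H by (rule smooth_on_frechet_derivative)

lemma differentiable_dH: "p \<in> W \<Longrightarrow> dH k differentiable (at (pp_proj p))"
  using smooth_on_differentiable[OF smooth_dH] by blast

lemma pderiv_at_H:
  assumes "p \<in> W"
  shows "pderiv_at k (\<lambda>q. H (x_of q) (u_of q)) p = dH k (pp_proj p)"
  unfolding dH_def using open_W assms
  by (rule pderiv_at_comp_proj)
    (use smooth_on_differentiable[OF smooth_H] assms in \<open>auto simp: pp_proj_def\<close>)

lemma dH_CV: "p \<in> W \<Longrightarrow> dH CV (pp_proj p) = 0"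
  unfolding dH_def using smooth_on_differentiable[OF smooth_H]
  by (simp add: linear_0 linear_frechet_derivative)

text \<open>The inverse metric pairs an upper u only with \<open>m = CV\<close>; the entries of the
  metric in row v are constant and no entry depends on v. Equivalently, du is covariantly
  constant.\<close>

lemma christoffel_CU: "p \<in> W \<Longrightarrow> christoffel (pp_metric H) CU k l p = 0"
  by (simp add: christoffel_def inv_metric_pp_metric pderiv_at_pp_metric pderiv_at_H sum_coord dH_CV)

lemma christoffel_CX:
  "p \<in> W \<Longrightarrow> christoffel (pp_metric H) (CX \<rho>) k l p =
    (if k = CU \<and> l = CU then - dH (CX \<rho>) (pp_proj p) / 2 else 0)"
  by (simp add: christoffel_def inv_metric_pp_metric pderiv_at_pp_metric pderiv_at_H sum_coord
      if_distrib[of "\<lambda>x. x * _"] sum_negf flip: sum_divide_distrib cong: if_cong)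

text \<open>The entry -H of the inverse metric multiplies the expression that already vanishes for
  upper index u, so H enters only through its derivatives.\<close>

lemma christoffel_CV:
  "p \<in> W \<Longrightarrow> christoffel (pp_metric H) CV k l p =
    ((if l = CU then dH k (pp_proj p) else 0) + (if k = CU then dH l (pp_proj p) else 0)
      - (if k = CU \<and> l = CU then dH CU (pp_proj p) else 0)) / 2"
  by (simp add: christoffel_def inv_metric_pp_metric pderiv_at_pp_metric pderiv_at_H sum_coord dH_CV)

lemmas christoffel_pp = christoffel_CU christoffel_CX christoffel_CV dH_CV

lemma pderiv_at_eq_0:
  assumes "p \<in> W" "\<And>q. q \<in> W \<Longrightarrow> f q = 0"
  shows "pderiv_at k f p = 0"
  using pderiv_at_cong_open[OF open_W assms(1), of f "\<lambda>_. 0"] assms(2) by simp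

lemma pderiv_at_CV_christoffel_CV:
  assumes "p \<in> W"
  shows "pderiv_at CV (christoffel (pp_metric H) CV k l) p = 0"
proof (rule pderiv_at_v_comp_proj[OF open_W assms])
  let ?F = "\<lambda>z. ((if l = CU then dH k z else 0) + (if k = CU then dH l z else 0)
    - (if k = CU \<and> l = CU then dH CU z else 0)) / 2"
  show "christoffel (pp_metric H) CV k l q = ?F (pp_proj q)" if "q \<in> W" for q
    using that by (rule christoffel_CV)
  have "(\<lambda>z. if P then dH k z else 0) differentiable (at (pp_proj p))" for P k
    using differentiable_dH[OF assms] by (cases P) simp_all
  then show "?F differentiable (at (pp_proj p))"
    by (intro derivative_intros) simp_all
qed

lemma pderiv_at_CX_christoffel_CX:
  assumes "p \<in> W"
  shows "pderiv_at (CX \<rho>) (christoffel (pp_metric H) (CX \<rho>) k l) p =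
    (if k = CU \<and> l = CU
     then - frechet_derivative (dH (CX \<rho>)) (at (pp_proj p)) (axis \<rho> 1, 0) / 2 else 0)"
proof (cases "k = CU \<and> l = CU")
  case True
  let ?D = "frechet_derivative (dH (CX \<rho>)) (at (pp_proj p))"
  have D: "((\<lambda>z. - dH (CX \<rho>) z / 2) has_derivative (\<lambda>h. - ?D h / 2)) (at (pp_proj p))"
    using differentiable_dH[OF assms] by (auto intro!: derivative_eq_intros simp: frechet_derivative_works)
  have "pderiv_at (CX \<rho>) (christoffel (pp_metric H) (CX \<rho>) k l) p =
      frechet_derivative (\<lambda>z. - dH (CX \<rho>) z / 2) (at (pp_proj p)) (pp_proj (axis (CX \<rho>) 1))"
    using open_W assms
    by (rule pderiv_at_comp_proj) (use D True in \<open>auto simp: christoffel_CX differentiable_def\<close>)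
  also have "\<dots> = - ?D (axis \<rho> 1, 0) / 2"
    using frechet_derivative_at[OF D] by (metis pp_proj_axis(2))
  finally show ?thesis
    using True by simp
next
  case False
  then have "christoffel (pp_metric H) (CX \<rho>) k l q = 0" if "q \<in> W" for q
    using that by (auto simp: christoffel_CX)
  then show ?thesis
    using False by (subst pderiv_at_eq_0[OF assms]) auto
qed

text \<open>The trace term and both quadratic terms of \<open>riemann\<close> vanish, leaving the
  divergence of the Christoffel symbols in the upper index. Its u and v terms are zero, and the
  transverse terms add up to \<open>psi\<close>.\<close>

lemma ricci_pp:
  assumes "p \<in> W"
  shows "ricci (pp_metric H) p $ j $ l = (if j = CU \<and> l = CU then psi (pp_proj p) else 0)"
proof -
  let ?\<Gamma> = "christoffel (pp_metric H)"
  \<comment> \<open>Each diagonal symbol vanishes without summation: an upper transverse index needs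
    both lower indices u, and upper v with lower v leaves only a v-derivative of H.\<close>
  have trace: "?\<Gamma> i i s q = 0" if "q \<in> W" for i s q
    using that by (cases i) (simp_all add: christoffel_pp)
  \<comment> \<open>For \<open>s = CU\<close> the second factor vanishes, for \<open>s = CV\<close>
    the first, because a lower v kills every symbol. For transverse \<open>s\<close> the second
    factor needs \<open>i = CU\<close>, which kills the first.\<close>
  have prod: "?\<Gamma> i l s p * ?\<Gamma> s i j p = 0" for i s
    using assms by (cases i; cases s) (simp_all add: christoffel_pp)
  have "riemann (pp_metric H) i j i l p = pderiv_at i (?\<Gamma> i l j) p" for i
    using pderiv_at_eq_0[OF assms, of "?\<Gamma> i i j"]
    by (simp add: riemann_def trace prod assms)
  then have "ricci (pp_metric H) p $ j $ l = (\<Sum>i\<in>UNIV. pderiv_at i (?\<Gamma> i l j) p)"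
    by (simp add: ricci_def)
  also have "\<dots> = (\<Sum>\<rho>\<in>UNIV. pderiv_at (CX \<rho>) (?\<Gamma> (CX \<rho>) l j) p)"
    using assms by (simp add: sum_coord pderiv_at_CV_christoffel_CV pderiv_at_eq_0 christoffel_CU)
  also have "\<dots> = (if j = CU \<and> l = CU then psi (pp_proj p) else 0)"
    using assms by (auto simp: pderiv_at_CX_christoffel_CX psi_def sum_divide_distrib sum_negf)
  finally show ?thesis .
qed

section \<open>The Ricci coefficient and its derivatives\<close>

lemma psi_transverse_laplacian:
  assumes "p \<in> W"
  shows "psi (pp_proj p) = - transverse_laplacian H (x_of p) (u_of p) / 2"
proof -
  define x u where "x = x_of p" and "u = u_of p"
  have mem: "(x, u) \<in> pp_proj ` W"
    using assms by (auto simp: x_def u_def pp_proj_def)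
  \<comment> \<open>The first derivative is identified at every \<open>y\<close> of the slice, not
    only at \<open>x\<close>, because it is differentiated once more.\<close>
  have "pderiv_at \<rho> (\<lambda>y. H y u) y = dH (CX \<rho>) (y, u)" if "(y, u) \<in> pp_proj ` W" for y \<rho>
    unfolding dH_def pp_proj_axis using open_proj_W that
    by (rule pderiv_at_slice) (use smooth_on_differentiable[OF smooth_H that] in auto)
  then have "pderiv_at \<rho> (pderiv_at \<rho> (\<lambda>y. H y u)) x =
      frechet_derivative (dH (CX \<rho>)) (at (x, u)) (axis \<rho> 1, 0)" for \<rho>
    using smooth_on_differentiable[OF smooth_dH mem]
    by (intro pderiv_at_slice[OF open_proj_W mem]) auto
  then show ?thesis
    by (simp add: psi_def transverse_laplacian_def pp_proj_def x_def u_def)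
qed

text \<open>The u-derivative of \<open>psi\<close>, expanded into third derivatives of H so that
  smoothness of H gives its differentiability.\<close>

definition dpsi_u :: "(real^'d) \<times> real \<Rightarrow> real"
  where "dpsi_u z = - (\<Sum>\<rho>\<in>UNIV.
    frechet_derivative (\<lambda>z. frechet_derivative (dH (CX \<rho>)) (at z) (axis \<rho> 1, 0)) (at z) (0, 1)) / 2"

lemma has_derivative_psi:
  assumes "p \<in> W"
  shows "(psi has_derivative (\<lambda>h. - (\<Sum>\<rho>\<in>UNIV.
    frechet_derivative (\<lambda>z. frechet_derivative (dH (CX \<rho>)) (at z) (axis \<rho> 1, 0))
      (at (pp_proj p)) h) / 2))
    (at (pp_proj p))"
proof -
  have "((\<lambda>z. frechet_derivative (dH (CX \<rho>)) (at z) (axis \<rho> 1, 0)) has_derivative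
      frechet_derivative (\<lambda>z. frechet_derivative (dH (CX \<rho>)) (at z) (axis \<rho> 1, 0)) (at (pp_proj p)))
      (at (pp_proj p))" for \<rho>
    using smooth_on_differentiable[OF smooth_on_frechet_derivative[OF smooth_dH]] assms
    by (simp add: frechet_derivative_works)
  then show ?thesis
    unfolding psi_def[abs_def] by (auto intro!: derivative_eq_intros)
qed

lemma differentiable_psi: "p \<in> W \<Longrightarrow> psi differentiable (at (pp_proj p))"
  using has_derivative_psi unfolding differentiable_def by blast

lemma differentiable_dpsi_u:
  assumes "p \<in> W" shows "dpsi_u differentiable (at (pp_proj p))"
proof -
  have "(\<lambda>z. frechet_derivative (\<lambda>z. frechet_derivative (dH (CX \<rho>)) (at z) (axis \<rho> 1, 0)) (at z) (0, 1))
      differentiable (at (pp_proj p))" for \<rho>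
    using smooth_on_differentiable[OF smooth_on_frechet_derivative[OF
        smooth_on_frechet_derivative[OF smooth_dH]]] assms by blast
  then show ?thesis
    unfolding dpsi_u_def[abs_def] by (auto intro!: derivative_intros)
qed

lemma pderiv_at_psi:
  assumes "p \<in> W"
  shows "pderiv_at CU (\<lambda>q. psi (pp_proj q)) p = dpsi_u (pp_proj p)"
    and "pderiv_at CV (\<lambda>q. psi (pp_proj q)) p = 0"
  using pderiv_at_comp_proj[OF open_W assms _ differentiable_psi[OF assms], of "\<lambda>q. psi (pp_proj q)" CU]
    pderiv_at_v_comp_proj[OF open_W assms _ differentiable_psi[OF assms], of "\<lambda>q. psi (pp_proj q)"]
    frechet_derivative_at[OF has_derivative_psi[OF assms], symmetric]
  by (simp_all add: dpsi_u_def)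

text \<open>On the open set \<open>W\<close> a vanishing field has vanishing derivatives. This
  carries the vanishing of one power of \<open>box\<close> over to the next.\<close>

lemma box_eq_0:
  assumes "p \<in> W" "\<And>q. q \<in> W \<Longrightarrow> T q = 0"
  shows "box (pp_metric H) T p = 0"
proof -
  have "cov_deriv2 (pp_metric H) T n k l q = 0" if "q \<in> W" for n k l q
    using that assms(2) by (simp add: cov_deriv2_def pderiv_at_eq_0)
  then show ?thesis
    using assms(1) by (simp add: box_def cov_deriv3_def pderiv_at_eq_0 vec_eq_iff)
qed

end

section \<open>Transverse Laplacian depending on u alone\<close>

locale pp_chart_uniform = pp_chart +
  fixes f :: "real \<Rightarrow> real"
  assumes transverse_laplacian_H: "p \<in> W \<Longrightarrow> transverse_laplacian H (x_of p) (u_of p) = f (u_of p)"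
begin

text \<open>With u frozen, \<open>psi\<close> is constant on the slice. The function
  \<open>f\<close> itself is never differentiated; derivatives in u are taken of
  \<open>psi\<close>.\<close>

lemma pderiv_at_CX_psi:
  assumes "p \<in> W"
  shows "pderiv_at (CX \<rho>) (\<lambda>q. psi (pp_proj q)) p = 0"
proof -
  have mem: "(x_of p, u_of p) \<in> pp_proj ` W"
    using assms by (auto simp: pp_proj_def)
  have psi: "psi (y, v) = - f v / 2" if "(y, v) \<in> pp_proj ` W" for y v
    using that psi_transverse_laplacian transverse_laplacian_H by (auto simp: pp_proj_def)
  have "pderiv_at \<rho> (\<lambda>_. - f (u_of p) / 2) (x_of p) =
      frechet_derivative psi (at (x_of p, u_of p)) (axis \<rho> 1, 0)"
    using differentiable_psi[OF assms]
    by (intro pderiv_at_slice[OF open_proj_W mem]) (auto simp: psi pp_proj_def)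
  then show ?thesis
    using pderiv_at_comp_proj[OF open_W assms _ differentiable_psi[OF assms],
        of "\<lambda>q. psi (pp_proj q)" "CX \<rho>"]
    by (simp add: pp_proj_def [of p])
qed

lemma cov_deriv2_ricci:
  assumes "p \<in> W"
  shows "cov_deriv2 (pp_metric H) (ricci (pp_metric H)) m k l p =
    (if m = CU \<and> k = CU \<and> l = CU then dpsi_u (pp_proj p) else 0)"
proof -
  have "pderiv_at m (\<lambda>q. ricci (pp_metric H) q $ k $ l) p =
      pderiv_at m (\<lambda>q. if k = CU \<and> l = CU then psi (pp_proj q) else 0) p"
    using open_W assms by (rule pderiv_at_cong_open) (rule ricci_pp)
  also have "\<dots> = (if m = CU \<and> k = CU \<and> l = CU then dpsi_u (pp_proj p) else 0)"
    using assms by (cases "k = CU \<and> l = CU"; cases m) (auto simp: pderiv_at_psi pderiv_at_CX_psi)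
  finally show ?thesis
    using assms by (simp add: cov_deriv2_def ricci_pp sum_coord christoffel_CU)
qed

lemma box_ricci:
  assumes "p \<in> W"
  shows "box (pp_metric H) (ricci (pp_metric H)) p = 0"
proof -
  let ?S = "cov_deriv2 (pp_metric H) (ricci (pp_metric H))"
  have v: "pderiv_at CV (?S n k l) p = 0" for n k l
  proof (cases "n = CU \<and> k = CU \<and> l = CU")
    case True
    then show ?thesis
      using pderiv_at_v_comp_proj[OF open_W assms _ differentiable_dpsi_u[OF assms]]
      by (simp add: cov_deriv2_ricci)
  next
    case False
    then show ?thesis
      using assms by (auto intro!: pderiv_at_eq_0 simp: cov_deriv2_ricci)
  qed
  \<comment> \<open>Only \<open>n = CU\<close> gives a nonzero component; the inverse metric pairs
    it with \<open>m = CV\<close> alone, and the v-derivative is zero.\<close>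
  have "inv_metric (pp_metric H) p $ m $ n * pderiv_at m (?S n k l) p = 0" for m n k l
  proof (cases "n = CU")
    case True
    then show ?thesis
      by (cases m) (simp_all add: inv_metric_pp_metric v)
  next
    case False
    then show ?thesis
      using assms by (simp add: pderiv_at_eq_0 cov_deriv2_ricci)
  qed
  moreover have "cov_deriv3 (pp_metric H) ?S m n k l p = pderiv_at m (?S n k l) p" for m n k l
    using assms by (simp add: cov_deriv3_def cov_deriv2_ricci sum_coord christoffel_CU)
  ultimately show ?thesis
    by (simp only: box_def vec_eq_iff) simp
qed

text \<open>The exponent starts at one because the zeroth power is the Ricci tensor. Each further
  step uses vanishing on all of \<open>W\<close>, hence the induction over arbitrary
  \<open>p\<close>.\<close>

lemma box_power_ricci:
  assumes "p \<in> W"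
  shows "((box (pp_metric H) ^^ Suc i) (ricci (pp_metric H))) p = 0"
  using assms
proof (induction i arbitrary: p)
  case 0
  then show ?case
    by (simp add: box_ricci)
next
  case (Suc i)
  then show ?case
    using box_eq_0[of p "(box (pp_metric H) ^^ Suc i) (ricci (pp_metric H))"] by simp
qed

end

section \<open>Field equations and radiation source\<close>

theorem proposition4p1:
  fixes H :: "real^'d \<Rightarrow> real \<Rightarrow> real"
    and W :: "(real^('d::finite coord)) set"
    and a :: "nat \<Rightarrow> real"
  assumes "CARD('d) \<ge> 2"
    and "open W"
    and "smooth_on ((\<lambda>p. (x_of p, u_of p)) ` W) (\<lambda>(x, u). H x u)"
    and "\<exists>f :: real \<Rightarrow> real. \<forall>p\<in>W. transverse_laplacian H (x_of p) (u_of p) = f (u_of p)"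
  shows "\<exists>T. generic_field_equations a W (pp_metric H) T
    \<and> (\<exists>F. null_radiation W (pp_metric H) F T)
    \<and> ((\<forall>p\<in>W. a 0 * transverse_laplacian H (x_of p) (u_of p) \<le> 0)
        \<longrightarrow> pure_radiation W (pp_metric H) T)"
proof -
  obtain f where "\<forall>p\<in>W. transverse_laplacian H (x_of p) (u_of p) = f (u_of p)"
    using assms(4) by blast
  then interpret pp_chart_uniform H W f
    using assms(2,3) by unfold_locales (auto simp: pp_proj_def[abs_def])
  define T where "T p = a 0 *\<^sub>R ricci (pp_metric H) p" for p
  \<comment> \<open>\<open>F\<close> is left open because two forms are used:
    \<open>a 0 * psi\<close> itself and, under the sign condition, the square of its root.\<close>
  have radiation: "null_radiation W (pp_metric H) F T"
    if "\<And>p. p \<in> W \<Longrightarrow> F p = a 0 * psi (pp_proj p)" for F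
    unfolding null_radiation_def
  \<comment> \<open>The witness is the covector du, null because the \<open>uu\<close> entry of the
    inverse metric is zero.\<close>
  proof (intro exI[of _ "\<lambda>_. axis CU 1"] conjI ballI allI)
    show "smooth_on W (\<lambda>_. axis CU (1::real))"
      by (rule smooth_on_const)
  next
    fix p assume "p \<in> W"
    then show "T p $ i $ j = F p * axis CU 1 $ i * axis CU 1 $ j" for i j
      by (simp add: that T_def ricci_pp axis_def)
    show "axis CU 1 \<noteq> (0 :: real^'d coord)"
      by (simp add: axis_eq_0_iff)
    show "(\<Sum>i\<in>UNIV. \<Sum>j\<in>UNIV. inv_metric (pp_metric H) p $ i $ j * axis CU 1 $ i * axis CU 1 $ j) = 0"
      by (simp add: sum_coord axis_def inv_metric_pp_metric)
  qed
  have "generic_field_equations a W (pp_metric H) T"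
    unfolding generic_field_equations_def
  proof (intro ballI allI)
    fix p k l assume "p \<in> W"
    then have "a i * ((box (pp_metric H) ^^ i) (ricci (pp_metric H))) p $ k $ l =
        (if i = 0 then T p $ k $ l else 0)" for i
      \<comment> \<open>Blocking \<open>funpow.simps(2)\<close> keeps the power in the
        \<open>Suc\<close> form of \<open>box_power_ricci\<close>.\<close>
      by (cases i) (simp_all add: T_def box_power_ricci del: funpow.simps(2))
    then show "(\<lambda>i. a i * ((box (pp_metric H) ^^ i) (ricci (pp_metric H))) p $ k $ l) sums (T p $ k $ l)"
      using sums_single[of 0 "\<lambda>_. T p $ k $ l"] by simp
  qed
  moreover have "pure_radiation W (pp_metric H) T"
    if "\<forall>p\<in>W. a 0 * transverse_laplacian H (x_of p) (u_of p) \<le> 0"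
    unfolding pure_radiation_def
  proof (intro exI radiation)
    fix p assume "p \<in> W"
    \<comment> \<open>Since \<open>psi\<close> is minus half the transverse Laplacian, the sign
      condition says exactly this, and the real root serves as \<Phi>.\<close>
    then have "0 \<le> a 0 * psi (pp_proj p)"
      using that by (simp add: psi_transverse_laplacian)
    then show "(sqrt (a 0 * psi (pp_proj p)))\<^sup>2 = a 0 * psi (pp_proj p)"
      by simp
  qed
  moreover have "null_radiation W (pp_metric H) (\<lambda>p. a 0 * psi (pp_proj p)) T"
    by (rule radiation) simp
  ultimately show ?thesis
    by blast
qed

end
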